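(* Let $d\ge 1$ be an integer and let $(P,H,I)$ be an incidence geometry such that $I$ is a basis of the $d$-plane matroid. Given $p,q \in P$, there exists a nonzero $\lambda \in \mathbb{R}$ such that for all $S \in \mathbb{R}^{d\times H}$ $$\det M_S^p(P,H,I) = \lambda \det M_S^q(P,H,I).$$
   Context: An incidence geometry is a triple $(P,H,I)$ where $P$ is a finite set (of points), $H$ is a finite set (of hyperplanes) and $I \subseteq P\times H$ is an arbitrary subset (of incidences). $\mathbb{R}^{d\times H}$ denotes the set of real matrices with $d$ rows and with columns indexed by $H$; the column of $S$ indexed by $h$ is $S_h$. For $I''\subseteq I$, let $P(I'')$ and $H(I'')$ denote the projections of $I''\subseteq P\times H$ to $P$ and $H$. In the $d$-plane matroid on $I$, a set $I'\subseteq I$ is independent if $|I''|\le |H(I'')|+d|P(I'')|-d$ for all nonempty $I''\subseteq I'$. "$I$ is a basis of the $d$-plane matroid" means that $I$ is independent in this sense and $|I| = |H|+d|P|-d$. Given $S\in\mathbb{R}^{d\times H}$, $M_S(P,H,I)$ is the $|I|\times(|H|+d|P|)$ matrix whose rows are indexed by $I$ and whose columns are as follows: each $h\in H$ indexes one column and each $p\in P$ indexes a block of $d$ columns. The row of the incidence $(p,h)\in I$ has entry $1$ in the column of $h$, has the $d$ entries of $S_h$ in the $d$ columns of $p$ (in order), and is zero elsewhere; i.e. it is the coefficient vector of the linear functional $(x,y)\mapsto \langle S_h, x_p\rangle + y_h$ with $x_p\in\mathbb{R}^d$, $y_h\in\mathbb{R}$. For $p\in P$, the pinned matrix $M_S^p(P,H,I)$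 is obtained from $M_S(P,H,I)$ by adding, for each of the $d$ columns indexed by $p$, one new row that is zero except for a $1$ in that column. It has size $(|I|+d)\times(|H|+d|P|)$, hence is square when $|I| = |H|+d|P|-d$. Orderings of rows and columns are fixed independently of $S$. *)

theory Defs
  imports "Jordan_Normal_Form.Determinant"
begin

definition incidence_geometry :: "'p set \<Rightarrow> 'h set \<Rightarrow> ('p \<times> 'h) set \<Rightarrow> bool" where
  "incidence_geometry P H I \<longleftrightarrow> finite P \<and> finite H \<and> I \<subseteq> P \<times> H"

(* The inequality is stated over the integers because of the subtraction of d. *)
definition plane_independent :: "nat \<Rightarrow> ('p \<times> 'h) set \<Rightarrow> bool" where
  "plane_independent d I \<longleftrightarrow>
     (\<forall>J. J \<subseteq> I \<and> J \<noteq> {} \<longrightarrow>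
        int (card J) \<le> int (card (snd ` J)) + int d * int (card (fst ` J)) - int d)"

definition plane_basis :: "nat \<Rightarrow> 'p set \<Rightarrow> 'h set \<Rightarrow> ('p \<times> 'h) set \<Rightarrow> bool" where
  "plane_basis d P H I \<longleftrightarrow>
     plane_independent d I \<and> int (card I) = int (card H) + int d * int (card P) - int d"

(* A real matrix S with d rows and columns indexed by H is a function of a row index i < d
   and of h; values outside this range do not enter the matrices below.
   Column indices: Inl h is the column of the hyperplane h, and Inr (p, i) is the i-th column
   (0 <= i < d) of the block of the point p. *)
definition plane_cols :: "nat \<Rightarrow> 'p set \<Rightarrow> 'h set \<Rightarrow> ('h + 'p \<times> nat) set" where
  "plane_cols d P H = H <+> (P \<times> {..<d})"

(* Entries of M_S(P,H,I). *)
fun plane_entry :: "(nat \<Rightarrow> 'h \<Rightarrow> real) \<Rightarrow> 'p \<times> 'h \<Rightarrow> 'h + 'p \<times> nat \<Rightarrow> real" where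
  "plane_entry S (p, h) (Inl h') = (if h' = h then 1 else 0)"
| "plane_entry S (p, h) (Inr (p', i)) = (if p' = p then S i h else 0)"

(* Row indices of the pinned matrix: Inl (p, h) is the row of an incidence, and Inr i is the
   additional row with its 1 in the i-th column of the block of the pinned point. *)
definition pinned_rows :: "nat \<Rightarrow> ('p \<times> 'h) set \<Rightarrow> ('p \<times> 'h + nat) set" where
  "pinned_rows d I = I <+> {..<d}"

fun pinned_entry ::
  "(nat \<Rightarrow> 'h \<Rightarrow> real) \<Rightarrow> 'p \<Rightarrow> 'p \<times> 'h + nat \<Rightarrow> 'h + 'p \<times> nat \<Rightarrow> real" where
  "pinned_entry S p (Inl e) c = plane_entry S e c"
| "pinned_entry S p (Inr i) c = (if c = Inr (p, i) then 1 else 0)"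

definition is_ordering :: "'a list \<Rightarrow> 'a set \<Rightarrow> bool" where
  "is_ordering xs A \<longleftrightarrow> distinct xs \<and> set xs = A"

(* The pinned matrix M_S^p(P,H,I), where the lists rs and cs are orderings of its row and
   column indices. *)
definition pinned_matrix ::
  "(nat \<Rightarrow> 'h \<Rightarrow> real) \<Rightarrow> 'p \<Rightarrow> ('p \<times> 'h + nat) list \<Rightarrow> ('h + 'p \<times> nat) list \<Rightarrow> real mat" where
  "pinned_matrix S p rs cs =
     mat (length rs) (length cs) (\<lambda>(a, b). pinned_entry S p (rs ! a) (cs ! b))"

end

theory Submission
  imports Defs "Jordan_Normal_Form.Char_Poly"
begin

text \<open>
  For every vector \<open>v\<close> the kernel of the incidence rows contains the translation
  \<open>x\<^sub>p = v\<close> (all \<open>p\<close>), \<open>y\<^sub>h = - \<langle>S\<^sub>h, v\<rangle>\<close>.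
  Consider the linear map that sends \<open>(x, y)\<close> to its translate by \<open>x\<^sub>p - x\<^sub>q\<close>. It does not
  change the values of the incidence rows, and the new \<open>x\<^sub>q\<close> is the old \<open>x\<^sub>p\<close>; hence composing
  the matrix pinned at \<open>q\<close> with it gives the matrix pinned at \<open>p\<close>
  (\<open>pinned_entry_pin_shift\<close>). The map is \<open>1 + N\<close>, where \<open>N\<close> takes \<open>(x, y)\<close> to the translation
  by \<open>x\<^sub>p - x\<^sub>q\<close>; a translation moves \<open>x\<^sub>p\<close> and \<open>x\<^sub>q\<close> equally, so \<open>N\<^sup>2 = 0\<close>
  and the map has determinant 1 for all \<open>S\<close> (\<open>det_one_plus_square_zero\<close>).
  So with equally ordered rows the two determinants coincide, and \<open>\<lambda>\<close> is the sign of the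
  permutation between the two row orderings. That \<open>I\<close> is a basis enters through its
  cardinality, which makes the pinned matrices square.
\<close>

section \<open>Determinants\<close>

text \<open>The determinant of \<open>1 + X N\<close> over the polynomial ring is a unit, since \<open>1 - X N\<close> is an
  inverse, hence is a constant. Its values at 0 and at 1 therefore agree.\<close>

lemma det_one_plus_square_zero:
  fixes N :: "'a :: field mat"
  assumes N: "N \<in> carrier_mat n n" and sq: "N * N = 0\<^sub>m n n"
  shows "det (1\<^sub>m n + N) = 1"
proof -
  \<comment> \<open>\<open>Q\<close> is \<open>X N\<close>, and \<open>B\<close> is the inverse of \<open>A\<close>.\<close>
  define Q where "Q = map_mat (\<lambda>a. [:0, a:]) N"
  define A where "A = 1\<^sub>m n + Q"
  define B where "B = 1\<^sub>m n + (- Q)"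
  have Q: "Q \<in> carrier_mat n n" using N by (simp add: Q_def)
  have A: "A \<in> carrier_mat n n" and B: "B \<in> carrier_mat n n" using Q by (auto simp: A_def B_def)
  have "Q * Q = 0\<^sub>m n n"
  proof (rule eq_matI)
    fix i j assume ij: "i < dim_row (0\<^sub>m n n :: 'a poly mat)" "j < dim_col (0\<^sub>m n n :: 'a poly mat)"
    have "(\<Sum>k<n. N $$ (i, k) * N $$ (k, j)) = (N * N) $$ (i, j)"
      using N ij by (simp add: scalar_prod_def atLeast0LessThan)
    also have "\<dots> = 0" using sq ij by simp
    finally have 0: "(\<Sum>k<n. N $$ (i, k) * N $$ (k, j)) = 0" .
    have "(Q * Q) $$ (i, j) = (\<Sum>k<n. monom (N $$ (i, k) * N $$ (k, j)) 2)"
      using N ij by (simp add: Q_def scalar_prod_def atLeast0LessThan monom_altdef power2_eq_square mult.commute)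
    also have "\<dots> = monom (\<Sum>k<n. N $$ (i, k) * N $$ (k, j)) 2"
      by (simp add: monom_sum)
    finally show "(Q * Q) $$ (i, j) = 0\<^sub>m n n $$ (i, j)" using 0 ij by simp
  qed (use Q in auto)
  moreover have "A * B = 1\<^sub>m n - Q * Q"
  proof -
    have "A * B = A * 1\<^sub>m n + A * (- Q)"
      unfolding B_def by (rule mult_add_distrib_mat[OF A]) (use Q in auto)
    also have "A * 1\<^sub>m n = A" using A by simp
    also have "A * (- Q) = - Q + Q * (- Q)"
      unfolding A_def using add_mult_distrib_mat[OF one_carrier_mat Q, of "- Q" n] Q by simp
    also have "Q * (- Q) = - (Q * Q)" using Q by simp
    finally show ?thesis unfolding A_def using Q by (intro eq_matI) auto
  qed
  ultimately have "A * B = 1\<^sub>m n" by auto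
  then have "det A * det B = 1" using det_mult[OF A B] by simp
  then have "det A dvd 1" by (metis dvd_triv_left)
  then obtain c where c: "det A = [:c:]" by (metis is_unit_polyE)
  have "poly (det A) 0 = det (1\<^sub>m n :: 'a mat)"
    using N A by (intro poly_det_cong) (auto simp: A_def Q_def)
  moreover have "poly (det A) 1 = det (1\<^sub>m n + N)"
    using N A by (intro poly_det_cong) (auto simp: A_def Q_def)
  ultimately show ?thesis using c by simp
qed

text \<open>The sign comes before the entries \<open>f\<close> in the conclusion because one sign must serve all
  \<open>S\<close>.\<close>

lemma det_reorder_rows:
  fixes rs rs' :: "'r list"
  assumes "distinct rs" "distinct rs'" "set rs = set rs'" "length rs = n"
  obtains s :: "'a :: comm_ring_1" where "s = 1 \<or> s = -1"
    "\<And>f :: 'r \<Rightarrow> nat \<Rightarrow> 'a. det (mat n n (\<lambda>(a, b). f (rs ! a) b)) = s * det (mat n n (\<lambda>(a, b). f (rs' ! a) b))"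
proof -
  have len: "length rs' = n" using assms distinct_card by metis
  have "mset rs = mset rs'" using assms set_eq_iff_mset_eq_distinct by blast
  then obtain \<pi> where \<pi>: "\<pi> permutes {..<length rs'}" "permute_list \<pi> rs' = rs"
    by (rule mset_eq_permutation)
  then have perm: "\<pi> permutes {0..<n}" using len by (simp add: atLeast0LessThan)
  have nth: "rs ! a = rs' ! \<pi> a" "\<pi> a < n" if "a < n" for a
    using \<pi> len that permute_list_nth[OF \<pi>(1) ] permutes_in_image[OF \<pi>(1)] by auto
  show thesis
  proof
    show "(signof \<pi> :: 'a) = 1 \<or> (signof \<pi> :: 'a) = -1" by (simp add: sign_def)
    fix f :: "'r \<Rightarrow> nat \<Rightarrow> 'a"
    have "mat n n (\<lambda>(a, b). f (rs ! a) b)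
        = mat n n (\<lambda>(a, b). mat n n (\<lambda>(a, b). f (rs' ! a) b) $$ (\<pi> a, b))"
      using nth by (intro eq_matI) auto
    then show "det (mat n n (\<lambda>(a, b). f (rs ! a) b))
        = signof \<pi> * det (mat n n (\<lambda>(a, b). f (rs' ! a) b))"
      using det_permute_rows[OF _ perm, of "mat n n (\<lambda>(a, b). f (rs' ! a) b)"] by simp
  qed
qed

section \<open>Moving the pin by a translation\<close>

text \<open>The motion \<open>x\<^sub>p = e\<^sub>j\<close>, \<open>y\<^sub>h = - \<langle>S\<^sub>h, e\<^sub>j\<rangle>\<close>, where \<open>e\<^sub>j\<close> is the \<open>j\<close>-th unit
  vector. The \<open>y\<close>-part is chosen so that the functionals \<open>\<langle>S\<^sub>h, x\<^sub>p\<rangle> + y\<^sub>h\<close> vanish.\<close>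

fun translation :: "(nat \<Rightarrow> 'h \<Rightarrow> real) \<Rightarrow> nat \<Rightarrow> 'h + 'p \<times> nat \<Rightarrow> real" where
  "translation S j (Inl h) = - S j h"
| "translation S j (Inr (p, i)) = (if i = j then 1 else 0)"

text \<open>The matrix of the linear map that sends \<open>(x, y)\<close> to the translation by
  \<open>x\<^sub>p - x\<^sub>q\<close>; the index \<open>c\<close> is that of the image.\<close>

fun pin_shift ::
  "(nat \<Rightarrow> 'h \<Rightarrow> real) \<Rightarrow> 'p \<Rightarrow> 'p \<Rightarrow> 'h + 'p \<times> nat \<Rightarrow> 'h + 'p \<times> nat \<Rightarrow> real" where
  "pin_shift S p q c (Inl h) = 0"
| "pin_shift S p q c (Inr (r, j)) = (of_bool (r = p) - of_bool (r = q)) * translation S j c"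

lemma sum_plane_cols:
  assumes "finite P" "finite H"
  shows "(\<Sum>c\<in>plane_cols d P H. f c) = (\<Sum>h\<in>H. f (Inl h)) + (\<Sum>r\<in>P. \<Sum>i<d. f (Inr (r, i)))"
proof -
  have "(\<Sum>x\<in>P \<times> {..<d}. f (Inr x)) = (\<Sum>r\<in>P. \<Sum>i<d. f (Inr (r, i)))"
    by (simp add: sum.cartesian_product split_beta)
  then show ?thesis
    using assms by (simp add: plane_cols_def sum.Plus)
qed

text \<open>In the row of \<open>(r, h)\<close> the column of \<open>h\<close> contributes \<open>- S j h\<close> and the block of \<open>r\<close>
  contributes \<open>S j h\<close>.\<close>

lemma plane_entry_translation:
  assumes "finite P" "finite H" "r \<in> P" "h \<in> H" "j < d"
  shows "(\<Sum>c\<in>plane_cols d P H. plane_entry S (r, h) c * translation S j c) = 0"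
proof -
  have "(\<Sum>r'\<in>P. \<Sum>i<d. plane_entry S (r, h) (Inr (r', i)) * translation S j (Inr (r', i)))
     = (\<Sum>r'\<in>P. if r' = r then S j h else 0)"
  proof (rule sum.cong[OF refl])
    fix r' assume "r' \<in> P"
    have "(\<Sum>i<d. plane_entry S (r, h) (Inr (r', i)) * translation S j (Inr (r', i)))
        = (\<Sum>i<d. if i = j then (if r' = r then S i h else 0) else 0)"
      by (rule sum.cong) auto
    then show "(\<Sum>i<d. plane_entry S (r, h) (Inr (r', i)) * translation S j (Inr (r', i)))
        = (if r' = r then S j h else 0)"
      using assms by simp
  qed
  moreover have "(\<Sum>h'\<in>H. plane_entry S (r, h) (Inl h') * translation S j (Inl h'))
      = (\<Sum>h'\<in>H. if h' = h then - S j h' else 0)"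
    by (rule sum.cong) auto
  ultimately show ?thesis
    using assms by (simp add: sum_plane_cols)
qed

lemma pinned_row_sum:
  assumes "finite P" "finite H" "q \<in> P" "i < d"
  shows "(\<Sum>c\<in>plane_cols d P H. pinned_entry S q (Inr i) c * g c) = g (Inr (q, i))"
proof -
  have "(\<Sum>c\<in>plane_cols d P H. pinned_entry S q (Inr i) c * g c)
      = (\<Sum>c\<in>plane_cols d P H. if c = Inr (q, i) then g c else 0)"
    by (intro sum.cong) auto
  also have "\<dots> = g (Inr (q, i))"
    using assms by (simp add: plane_cols_def Plus_def image_iff)
  finally show ?thesis .
qed

text \<open>This is the entrywise form of \<open>M\<^sup>q (1 + N) = M\<^sup>p\<close>. An incidence row annihilates the
  translations, so it is unchanged. The pinning row \<open>i\<close> reads off the \<open>i\<close>-th coordinate of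
  \<open>x\<^sub>q + (x\<^sub>p - x\<^sub>q) = x\<^sub>p\<close>.\<close>

lemma pinned_entry_pin_shift:
  assumes "incidence_geometry P H I" "p \<in> P" "q \<in> P"
    and "r \<in> pinned_rows d I" "c' \<in> plane_cols d P H"
  shows "pinned_entry S q r c' + (\<Sum>c\<in>plane_cols d P H. pinned_entry S q r c * pin_shift S p q c c')
    = pinned_entry S p r c'"
proof (cases c')
  case (Inl h)
  then show ?thesis by (cases r) auto
next
  case (Inr x)
  then obtain r' j where c': "c' = Inr (r', j)" by (cases x) auto
  then have j: "j < d" using assms(5) by (auto simp: plane_cols_def)
  have fin: "finite P" "finite H" and I: "I \<subseteq> P \<times> H"
    using assms(1) by (auto simp: incidence_geometry_def)
  have "(\<Sum>c\<in>plane_cols d P H. pinned_entry S q r c * pin_shift S p q c c')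
      = (of_bool (r' = p) - of_bool (r' = q))
        * (\<Sum>c\<in>plane_cols d P H. pinned_entry S q r c * translation S j c)"
    by (simp add: c' sum_distrib_left mult_ac)
  moreover have "(\<Sum>c\<in>plane_cols d P H. pinned_entry S q r c * translation S j c)
      = (case r of Inl e \<Rightarrow> 0 | Inr i \<Rightarrow> if i = j then 1 else 0)"
  proof (cases r)
    case (Inl e)
    then have "e \<in> P \<times> H" using assms(4) I by (auto simp: pinned_rows_def)
    then show ?thesis using Inl plane_entry_translation[OF fin _ _ j] by (cases e) auto
  next
    case (Inr i)
    then have "i < d" using assms(4) by (auto simp: pinned_rows_def)
    then show ?thesis using Inr pinned_row_sum[OF fin assms(3)] by simp
  qed
  ultimately show ?thesis using c' by (cases r) auto
qed

text \<open>The image of \<open>N\<close> consists of translations, and \<open>x\<^sub>p - x\<^sub>q\<close> vanishes on a translation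
  because \<open>p\<close> and \<open>q\<close> both lie in \<open>P\<close> and so move by the same vector.\<close>

lemma pin_shift_square_zero:
  assumes "finite P" "finite H" "p \<in> P" "q \<in> P" "c' \<in> plane_cols d P H"
  shows "(\<Sum>c\<in>plane_cols d P H. pin_shift S p q c0 c * pin_shift S p q c c') = 0"
proof (cases c')
  case (Inr x)
  then obtain r' j where c': "c' = Inr (r', j)" by (cases x) auto
  then have j: "j < d" using assms(5) by (auto simp: plane_cols_def)
  have "(\<Sum>i<d. pin_shift S p q c0 (Inr (r, i)) * translation S j (Inr (r, i)))
      = (of_bool (r = p) - of_bool (r = q)) * translation S j c0" for r
  proof -
    have "(\<Sum>i<d. pin_shift S p q c0 (Inr (r, i)) * translation S j (Inr (r, i)))
        = (\<Sum>i<d. if i = j then pin_shift S p q c0 (Inr (r, i)) else 0)"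
      by (rule sum.cong) auto
    then show ?thesis using j by simp
  qed
  then have "(\<Sum>c\<in>plane_cols d P H. pin_shift S p q c0 c * translation S j c)
      = (\<Sum>r\<in>P. (of_bool (r = p) - of_bool (r = q)) * translation S j c0)"
    using assms(1,2) by (simp add: sum_plane_cols)
  also have "\<dots> = ((\<Sum>r\<in>P. of_bool (r = p)) - (\<Sum>r\<in>P. of_bool (r = q))) * translation S j c0"
    by (simp add: left_diff_distrib sum_distrib_right sum_subtractf del: sum_of_bool_eq)
  also have "\<dots> = 0" using assms(1,3,4) by (simp add: of_bool_def)
  finally have "(\<Sum>c\<in>plane_cols d P H. pin_shift S p q c0 c * translation S j c) = 0" .
  then show ?thesis
    by (simp add: c' mult.left_commute flip: sum_distrib_left)
qed simp

lemma sum_nth_ordering: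
  assumes "is_ordering xs A"
  shows "(\<Sum>k<length xs. f (xs ! k)) = (\<Sum>x\<in>A. f x)"
  by (rule sum.reindex_bij_betw, rule bij_betw_nth) (use assms in \<open>auto simp: is_ordering_def\<close>)

lemma det_pinned_matrix_change_pin:
  assumes geom: "incidence_geometry P H I" and "p \<in> P" "q \<in> P"
    and cs: "is_ordering cs (plane_cols d P H)" and rs: "is_ordering rs (pinned_rows d I)"
    and sq: "length rs = length cs"
  shows "det (pinned_matrix S p rs cs) = det (pinned_matrix S q rs cs)"
proof -
  define n where "n = length cs"
  define N where "N = mat n n (\<lambda>(a, b). pin_shift S p q (cs ! a) (cs ! b))"
  let ?M = "\<lambda>r. pinned_matrix S r rs cs"
  have fin: "finite P" "finite H" using geom by (auto simp: incidence_geometry_def)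
  have N: "N \<in> carrier_mat n n" by (simp add: N_def)
  have M: "?M r \<in> carrier_mat n n" for r using sq by (simp add: pinned_matrix_def n_def)
  have cs_in: "cs ! a \<in> plane_cols d P H" if "a < n" for a
    using that cs nth_mem[of a cs] unfolding is_ordering_def n_def by blast
  have rs_in: "rs ! a \<in> pinned_rows d I" if "a < n" for a
    using that rs nth_mem[of a rs] unfolding is_ordering_def n_def sq by blast
  note sum_cs = sum_nth_ordering[OF cs, folded n_def]
  have "N * N = 0\<^sub>m n n"
  proof (rule eq_matI)
    fix a b assume ab: "a < dim_row (0\<^sub>m n n :: real mat)" "b < dim_col (0\<^sub>m n n :: real mat)"
    then have "(N * N) $$ (a, b)
        = (\<Sum>k<n. pin_shift S p q (cs ! a) (cs ! k) * pin_shift S p q (cs ! k) (cs ! b))"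
      by (simp add: N_def scalar_prod_def atLeast0LessThan)
    also have "\<dots> = 0"
      using sum_cs[of "\<lambda>c. pin_shift S p q (cs ! a) c * pin_shift S p q c (cs ! b)"]
        pin_shift_square_zero[OF fin assms(2,3) cs_in] ab by simp
    finally show "(N * N) $$ (a, b) = 0\<^sub>m n n $$ (a, b)" using ab by simp
  qed (use N in auto)
  then have det1: "det (1\<^sub>m n + N) = 1" using N by (rule det_one_plus_square_zero[rotated])
  have "?M q * (1\<^sub>m n + N) = ?M q * 1\<^sub>m n + ?M q * N"
    by (rule mult_add_distrib_mat[OF M _ N]) simp
  also have "?M q * 1\<^sub>m n = ?M q" by (rule right_mult_one_mat[OF M])
  also have "?M q + ?M q * N = ?M p"
  proof (rule eq_matI)
    fix a b assume "a < dim_row (?M p)" "b < dim_col (?M p)"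
    then have ab: "a < n" "b < n" using M[of p] by auto
    have "(?M q * N) $$ (a, b)
        = (\<Sum>k<n. pinned_entry S q (rs ! a) (cs ! k) * pin_shift S p q (cs ! k) (cs ! b))"
      using ab sq by (simp add: N_def pinned_matrix_def scalar_prod_def atLeast0LessThan n_def)
    also have "\<dots> = (\<Sum>c\<in>plane_cols d P H.
        pinned_entry S q (rs ! a) c * pin_shift S p q c (cs ! b))"
      by (rule sum_cs)
    finally have "(?M q + ?M q * N) $$ (a, b) = pinned_entry S q (rs ! a) (cs ! b) + \<dots>"
      using ab sq M[of q] N by (simp add: pinned_matrix_def n_def)
    also have "\<dots> = ?M p $$ (a, b)"
      using pinned_entry_pin_shift[OF geom assms(2,3) rs_in cs_in] ab sq
      by (simp add: pinned_matrix_def n_def)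
    finally show "(?M q + ?M q * N) $$ (a, b) = ?M p $$ (a, b)" .
  qed (use M[of p] M[of q] N in auto)
  finally show ?thesis
    using det_mult[OF M[of q], of "1\<^sub>m n + N"] N det1 by simp
qed

section \<open>Independence of the pinned point\<close>

theorem proposition3p2:
  fixes d :: nat and P :: "'p set" and H :: "'h set" and I :: "('p \<times> 'h) set"
    and p q :: 'p
    and cs :: "('h + 'p \<times> nat) list" and rs rs' :: "('p \<times> 'h + nat) list"
  assumes "d \<ge> 1"
    and "incidence_geometry P H I"
    and "plane_basis d P H I"
    and "p \<in> P" and "q \<in> P"
    and "is_ordering cs (plane_cols d P H)"
    and "is_ordering rs (pinned_rows d I)"
    and "is_ordering rs' (pinned_rows d I)"
  shows "\<exists>l::real. l \<noteq> 0 \<and>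
    (\<forall>S :: nat \<Rightarrow> 'h \<Rightarrow> real. det (pinned_matrix S p rs cs) = l * det (pinned_matrix S q rs' cs))"
proof -
  have fin: "finite P" "finite H" "finite I"
    using assms(2) finite_subset[of I "P \<times> H"] by (auto simp: incidence_geometry_def)
  have "length cs = card H + d * card P"
    using assms(6) fin distinct_card[of cs]
    by (simp add: is_ordering_def plane_cols_def card_Plus card_cartesian_product mult.commute)
  moreover have len: "length rs = card I + d" "length rs' = card I + d"
    using assms(7,8) fin distinct_card[of rs] distinct_card[of rs']
    by (simp_all add: is_ordering_def pinned_rows_def card_Plus)
  moreover have "int (card I) = int (card H) + int d * int (card P) - int d"
    using assms(3) by (simp add: plane_basis_def)
  then have "int (card I + d) = int (card H + d * card P)" by simp
  then have "card I + d = card H + d * card P" by (simp only: of_nat_eq_iff)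
  ultimately have sq: "length rs = length cs" "length rs' = length cs" by simp_all
  obtain s :: real where s: "s = 1 \<or> s = -1"
    and perm: "\<And>f. det (mat (length cs) (length cs) (\<lambda>(a, b). f (rs ! a) b))
      = s * det (mat (length cs) (length cs) (\<lambda>(a, b). f (rs' ! a) b))"
    using det_reorder_rows[of rs rs' "length cs"] assms(7,8) sq
    unfolding is_ordering_def by metis
  have "det (pinned_matrix S p rs cs) = s * det (pinned_matrix S q rs' cs)" for S
  proof -
    have "det (pinned_matrix S p rs cs) = s * det (pinned_matrix S p rs' cs)"
      using perm[of "\<lambda>r b. pinned_entry S p r (cs ! b)"] sq by (simp add: pinned_matrix_def)
    then show ?thesis
      using det_pinned_matrix_change_pin[OF assms(2,4,5,6,8) sq(2)] by simp
  qed
  then show ?thesis using s by (intro exI[of _ s]) auto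
qed

end
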